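(* Let $D$ be a digraph on $n$ vertices with out-degree sequence $d_1^+,\dots,d_n^+$. Then $$\mathrm{allarb}(D)\leq \sum_{k=1}^n\prod_{j\neq k}d_j^+< \prod_{k=1}^n(d^+_k+1).$$
   Context: Digraphs may have multiple edges; parallel edges are counted as distinct. An arborescence of a directed graph $D$ rooted at a vertex $v$ is a spanning tree of $D$ in which every vertex different from $v$ has out-degree $1$ and the root $v$ has out-degree $0$ (every edge of the tree is oriented towards the root). $\mathrm{arb}(D,v)$ is the number of arborescences of $D$ rooted at $v$, and $\mathrm{allarb}(D)=\sum_{v\in V}\mathrm{arb}(D,v)$, where $V$ is the vertex set of $D$. The out-degree $d_j^+$ of the $j$-th vertex is the number of edges of $D$ leaving it.
   Formalization: The strict inequality is stated for every digraph except the one with a single vertex and no edges (n = 1, out-degree 0), where it would read 1 < 1 and is false. *)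

theory Defs
  imports "Graph_Theory.Graph_Theory"
begin

text \<open>
  A digraph is a \<^locale>\<open>fin_digraph\<close>: finitely many vertices and arcs, parallel arcs
  (distinct elements of \<^const>\<open>arcs\<close> with the same ends) and loops allowed.
\<close>

text \<open>
  The underlying undirected multigraph: every arc \<open>e\<close> may be traversed forwards, as
  \<open>(e, False)\<close>, or backwards, as \<open>(e, True)\<close>.
\<close>

definition both_ways :: "('a, 'b) pre_digraph \<Rightarrow> ('a, 'b \<times> bool) pre_digraph" where
  "both_ways G =
    \<lparr> verts = verts G,
      arcs = arcs G \<times> UNIV,
      tail = (\<lambda>(e, b). if b then head G e else tail G e),
      head = (\<lambda>(e, b). if b then tail G e else head G e) \<rparr>"

text \<open>
  The library's \<^const>\<open>forest\<close> (hence \<^const>\<open>tree\<close> and \<^const>\<open>spanning_tree\<close>) only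
  forbids directed cycles. A tree must have no cycle in the underlying undirected multigraph.
  An undirected cycle uses no edge twice, so going back and forth along a single arc is not a
  cycle, whereas a loop and a pair of parallel or opposite arcs are.
  \<^const>\<open>connected\<close> already refers to the underlying undirected graph.
\<close>

definition undirected_tree :: "('a, 'b) pre_digraph \<Rightarrow> bool" where
  "undirected_tree G \<longleftrightarrow>
     connected G \<and>
     \<not> (\<exists>p. pre_digraph.cycle (both_ways G) p \<and> distinct (map fst p))"

definition arborescence :: "('a, 'b) pre_digraph \<Rightarrow> 'a \<Rightarrow> ('a, 'b) pre_digraph \<Rightarrow> bool" where
  "arborescence D v T \<longleftrightarrow>
     v \<in> verts D \<and> spanning T D \<and> undirected_tree T \<and>
     out_degree T v = 0 \<and> (\<forall>u \<in> verts D - {v}. out_degree T u = 1)"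

text \<open>
  A spanning subgraph of \<open>D\<close> inherits the functions \<^const>\<open>tail\<close> and \<^const>\<open>head\<close> of \<open>D\<close>,
  so it is determined by its set of arcs and the count below is of sets of arcs.
\<close>

definition arb :: "('a, 'b) pre_digraph \<Rightarrow> 'a \<Rightarrow> nat" where
  "arb D v = card {T. arborescence D v T}"

definition allarb :: "('a, 'b) pre_digraph \<Rightarrow> nat" where
  "allarb D = (\<Sum>v \<in> verts D. arb D v)"

end

theory Submission
  imports Defs
begin

text \<open>
  An arborescence rooted at \<open>v\<close> is determined by its arcs, and it contains exactly one arc
  leaving each vertex other than \<open>v\<close> and none leaving \<open>v\<close>. Choosing these arcs freely gives
  the product of the out-degrees over the vertices other than \<open>v\<close>, so this product bounds
  the number of arborescences; the gap counts the choices that contain a cycle.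

  The second inequality compares the sum with the expansion of \<open>\<Prod>k. (d k + 1)\<close> into the
  products of \<open>d\<close> over all subsets of the vertices. The complements of single vertices
  contribute the sum in the middle, and the empty subset, which is not such a complement
  unless there is just one vertex, contributes a further \<open>1\<close>. For a single vertex the
  inequality reads \<open>1 < d + 1\<close>, hence the exclusion of the one-vertex digraph without arcs.
\<close>

text \<open>
  Every arborescence is the graph spanned by some choice of one outgoing arc at each vertex
  but the root, namely of the arc by which the arborescence leaves that vertex: since the
  root has out-degree \<open>0\<close>, these are all its arcs. So there are at most as many
  arborescences as choices.
\<close>

lemma arb_le_prod_out_degree:
  fixes D :: "('a, 'b) pre_digraph"
  assumes "fin_digraph D"
  shows "arb D v \<le> (\<Prod>j \<in> verts D - {v}. out_degree D j)"
proof -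
  interpret fin_digraph D by fact
  let ?V = "verts D - {v}"
  let ?choices = "PiE ?V (out_arcs D)"
  define graph_of where
    "graph_of f = \<lparr> verts = verts D, arcs = f ` ?V, tail = tail D, head = head D \<rparr>"
    for f :: "'a \<Rightarrow> 'b"
  have "T \<in> graph_of ` ?choices" if "arborescence D v T" for T
  proof -
    from that have sub: "subgraph T D" and verts: "verts T = verts D"
      and root: "out_degree T v = 0" and out: "\<And>u. u \<in> ?V \<Longrightarrow> out_degree T u = 1"
      by (auto simp: arborescence_def spanning_def)
    from sub have arcs: "arcs T \<subseteq> arcs D" and "wf_digraph T"
      and compat: "tail T = tail D" "head T = head D"
      by (auto simp: subgraph_def compatible_def)
    interpret T: wf_digraph T by fact
    have "finite (arcs T)" using arcs finite_arcs by (rule finite_subset)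
    then have "out_arcs T v = {}"
      using root by (simp add: out_degree_def out_arcs_def)
    have "\<exists>e. out_arcs T u = {e}" if "u \<in> ?V" for u
      using out[OF that] by (simp add: out_degree_def card_1_singleton_iff)
    then obtain g where g: "\<And>u. u \<in> ?V \<Longrightarrow> out_arcs T u = {g u}"
      by metis
    have g_in: "g u \<in> out_arcs T u" if "u \<in> ?V" for u
      using g[OF that] by simp
    have "arcs T = g ` ?V"
    proof
      show "arcs T \<subseteq> g ` ?V"
      proof
        fix e assume e: "e \<in> arcs T"
        then have "e \<in> out_arcs T (tail T e)" by simp
        moreover from this have "tail T e \<in> ?V"
          using \<open>out_arcs T v = {}\<close> T.tail_in_verts[OF e] verts by auto
        ultimately have "e = g (tail T e)" using g by blast
        with \<open>tail T e \<in> ?V\<close> show "e \<in> g ` ?V" by (rule rev_image_eqI)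
      qed
      show "g ` ?V \<subseteq> arcs T" using g_in by fastforce
    qed
    then have "T = graph_of (restrict g ?V)"
      using verts compat by (simp add: graph_of_def)
    moreover have "restrict g ?V \<in> ?choices"
    proof (rule restrict_PiE_iff[THEN iffD2], rule ballI)
      fix u assume "u \<in> ?V"
      then have "g u \<in> out_arcs T u" by (rule g_in)
      then show "g u \<in> out_arcs D u" using arcs compat by auto
    qed
    ultimately show ?thesis by blast
  qed
  then have "{T. arborescence D v T} \<subseteq> graph_of ` ?choices" by blast
  moreover have "finite ?choices" by (intro finite_PiE) (simp_all add: out_arcs_def)
  ultimately have "arb D v \<le> card ?choices"
    unfolding arb_def by (meson card_image_le card_mono finite_imageI order_trans)
  then show ?thesis by (simp add: card_PiE out_degree_def)
qed

text \<open>
  Both sides are sums of products of \<open>d\<close> over subsets of \<open>A\<close>; on the right the empty subset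
  provides a term that is missing on the left as long as \<open>A\<close> is not a singleton.
\<close>

lemma sum_prod_remove1_less_prod_Suc:
  fixes d :: "'a \<Rightarrow> nat"
  assumes "finite A" and "card A \<noteq> 1"
  shows "(\<Sum>k \<in> A. \<Prod>j \<in> A - {k}. d j) < (\<Prod>k \<in> A. d k + 1)"
proof -
  let ?co = "(\<lambda>k. A - {k}) ` A"
  have "{} \<notin> ?co"
  proof
    assume "{} \<in> ?co"
    then obtain k where "k \<in> A" and "A - {k} = {}" by (elim imageE) simp
    then have "A = {k}" by blast
    with assms(2) show False by simp
  qed
  have "(\<Sum>k \<in> A. \<Prod>j \<in> A - {k}. d j) = (\<Sum>X \<in> ?co. prod d X)"
    by (subst sum.reindex) (auto simp: inj_on_def)
  also have "\<dots> < (\<Sum>X \<in> insert {} ?co. prod d X)"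
    using assms(1) \<open>{} \<notin> ?co\<close> by simp
  also have "\<dots> \<le> (\<Sum>X \<in> Pow A. prod d X)"
    using assms(1) by (intro sum_mono2) auto
  also have "\<dots> = (\<Prod>k \<in> A. d k + 1)"
    using prod_add[OF assms(1), of d "\<lambda>_. 1"] by simp
  finally show ?thesis .
qed

theorem proposition1p8:
  fixes D :: "('a, 'b) pre_digraph"
  assumes "fin_digraph D"
  shows "allarb D \<le> (\<Sum>k \<in> verts D. \<Prod>j \<in> verts D - {k}. out_degree D j) \<and>
         (\<not> (card (verts D) = 1 \<and> arcs D = {}) \<longrightarrow>
           (\<Sum>k \<in> verts D. \<Prod>j \<in> verts D - {k}. out_degree D j)
             < (\<Prod>k \<in> verts D. out_degree D k + 1))"
proof (intro conjI impI)
  interpret fin_digraph D by fact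
  show "allarb D \<le> (\<Sum>k \<in> verts D. \<Prod>j \<in> verts D - {k}. out_degree D j)"
    unfolding allarb_def by (intro sum_mono arb_le_prod_out_degree assms)
  assume nontrivial: "\<not> (card (verts D) = 1 \<and> arcs D = {})"
  show "(\<Sum>k \<in> verts D. \<Prod>j \<in> verts D - {k}. out_degree D j)
          < (\<Prod>k \<in> verts D. out_degree D k + 1)"
  proof (cases "card (verts D) = 1")
    case True
    then obtain v where v: "verts D = {v}" by (auto simp: card_1_singleton_iff)
    from True nontrivial obtain e where "e \<in> arcs D" by blast
    then have "e \<in> out_arcs D v" using tail_in_verts[of e] v by simp
    then have "out_degree D v > 0"
      by (auto simp: out_degree_def card_gt_0_iff)
    then show ?thesis by (simp add: v)
  next
    case False
    then show ?thesis by (intro sum_prod_remove1_less_prod_Suc) simp_all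
  qed
qed

end
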